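(* Let $\Phi:(S,\cdot)\to(T,\cdot)$ be a semigroup homomorphism such that $\Phi(S)$ is piecewise syndetic in $T$. If $A\subseteq S$ is central in $S$, then $\Phi(A)$ is central in $T$.
   Context: For a semigroup $(X,\cdot)$, $B\subseteq X$ and $x\in X$, let $x^{-1}B=\{y\in X: x\cdot y\in B\}$; for a set $Y$, $\mathcal P_f(Y)$ denotes the set of finite nonempty subsets of $Y$. A set $B\subseteq X$ is piecewise syndetic in $X$ if there exists $G\in\mathcal P_f(X)$ such that for every $F\in\mathcal P_f(X)$ there exists $x\in X$ with $F\cdot x\subseteq\bigcup_{t\in G}t^{-1}B$. A collection $\mathcal A$ of subsets of $X$ is collectionwise piecewise syndetic in $X$ if there exist functions $K:\mathcal P_f(\mathcal A)\to\mathcal P_f(X)$ and $x:\mathcal P_f(\mathcal A)\times\mathcal P_f(X)\to X$ such that for all $F\in\mathcal P_f(X)$ and all $\mathcal F,\mathcal H\in\mathcal P_f(\mathcal A)$ with $\mathcal F\subseteq\mathcal H$ one has $F\cdot x(\mathcal H,F)\subseteq\bigcup_{t\in K(\mathcal F)}t^{-1}\bigl(\bigcap\mathcal F\bigr)$. A family $\langle C_F\rangle_{F\in\mathcal I}$ is downward directed if $(\mathcal I,\geq)$ is directed and $F\geq G$ implies $C_F\subseteq C_G$. A set $A\subseteq X$ is central in $X$ if there is a downward directed family $\langle C_F\rangle_{F\in\mathcal I}$ of subsets of $A$ such that (1) for each $F\in\mathcal I$ and each $x\in C_F$ there is $G\in\mathcal I$ with $C_G\subseteq x^{-1}C_F$,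 and (2) $\{C_F:F\in\mathcal I\}$ is collectionwise piecewise syndetic in $X$. *)

theory Defs
  imports Main "HOL-Library.FuncSet"
begin

definition Pf :: "'a set \<Rightarrow> 'a set set" where
  "Pf Y = {F. finite F \<and> F \<noteq> {} \<and> F \<subseteq> Y}"

definition left_quot :: "'a::semigroup_mult \<Rightarrow> 'a set \<Rightarrow> 'a set" where
  "left_quot x B = {y. x * y \<in> B}"

definition piecewise_syndetic :: "'a::semigroup_mult set \<Rightarrow> bool" where
  "piecewise_syndetic B \<longleftrightarrow>
     (\<exists>G \<in> Pf UNIV. \<forall>F \<in> Pf UNIV. \<exists>x. (\<lambda>y. y * x) ` F \<subseteq> (\<Union>t\<in>G. left_quot t B))"

definition collectionwise_piecewise_syndetic :: "'a::semigroup_mult set set \<Rightarrow> bool" where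
  "collectionwise_piecewise_syndetic \<A> \<longleftrightarrow>
     (\<exists>K \<in> Pf \<A> \<rightarrow> Pf UNIV. \<exists>x :: 'a set set \<Rightarrow> 'a set \<Rightarrow> 'a.
        \<forall>F \<in> Pf UNIV. \<forall>\<F> \<in> Pf \<A>. \<forall>\<H> \<in> Pf \<A>. \<F> \<subseteq> \<H> \<longrightarrow>
          (\<lambda>y. y * x \<H> F) ` F \<subseteq> (\<Union>t\<in>K \<F>. left_quot t (\<Inter>\<F>)))"

text \<open>As usual, a directed set is a nonempty preordered set in which any two elements
  have an upper bound. Read \<open>ge i j\<close> as \<open>i \<ge> j\<close>.\<close>

definition directed :: "'i set \<Rightarrow> ('i \<Rightarrow> 'i \<Rightarrow> bool) \<Rightarrow> bool" where
  "directed I ge \<longleftrightarrow> I \<noteq> {} \<and> reflp_on I ge \<and> transp_on I ge \<and>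
     (\<forall>i\<in>I. \<forall>j\<in>I. \<exists>k\<in>I. ge k i \<and> ge k j)"

definition downward_directed ::
    "'i set \<Rightarrow> ('i \<Rightarrow> 'i \<Rightarrow> bool) \<Rightarrow> ('i \<Rightarrow> 'a set) \<Rightarrow> bool" where
  "downward_directed I ge C \<longleftrightarrow>
     directed I ge \<and> (\<forall>i\<in>I. \<forall>j\<in>I. ge i j \<longrightarrow> C i \<subseteq> C j)"

definition central_family ::
    "'i set \<Rightarrow> ('i \<Rightarrow> 'i \<Rightarrow> bool) \<Rightarrow> ('i \<Rightarrow> 'a::semigroup_mult set) \<Rightarrow> 'a set \<Rightarrow> bool" where
  "central_family I ge C A \<longleftrightarrow>
     downward_directed I ge C \<and> (\<forall>i\<in>I. C i \<subseteq> A) \<and>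
     (\<forall>i\<in>I. \<forall>x\<in>C i. \<exists>j\<in>I. C j \<subseteq> left_quot x (C i)) \<and>
     collectionwise_piecewise_syndetic (C ` I)"

text \<open>HOL cannot quantify existentially over the type of the index set, so the indices are
  taken from \<open>'a set\<close>. This is no restriction: by \<open>centralI\<close> below, a witnessing
  family over any index type will do.\<close>

definition central :: "'a::semigroup_mult set \<Rightarrow> bool" where
  "central A \<longleftrightarrow>
     (\<exists>(I :: 'a set set) (ge :: 'a set \<Rightarrow> 'a set \<Rightarrow> bool) (C :: 'a set \<Rightarrow> 'a set).
        central_family I ge C A)"

lemma centralI:
  fixes I :: "'i set" and C :: "'i \<Rightarrow> 'a::semigroup_mult set"
  assumes "central_family I ge C A"
  shows "central A"
proof -
  have dir: "directed I ge" and mono: "\<And>i j. i \<in> I \<Longrightarrow> j \<in> I \<Longrightarrow> ge i j \<Longrightarrow> C i \<subseteq> C j"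
    using assms by (simp_all add: central_family_def downward_directed_def)
  have "\<exists>Z \<in> C ` I. Z \<subseteq> X \<and> Z \<subseteq> Y" if XY: "X \<in> C ` I" "Y \<in> C ` I" for X Y
  proof -
    obtain i j where ij: "i \<in> I" "j \<in> I" "X = C i" "Y = C j"
      using XY by blast
    obtain k where "k \<in> I" "ge k i" "ge k j"
      using dir ij by (metis directed_def)
    then show ?thesis
      using mono ij by blast
  qed
  then have "directed (C ` I) (\<lambda>X Y. X \<subseteq> Y)"
    using dir by (simp add: directed_def reflp_on_def transp_on_def) blast
  then have "central_family (C ` I) (\<lambda>X Y. X \<subseteq> Y) (\<lambda>X. X) A"
    using assms by (simp add: central_family_def downward_directed_def)
  then show ?thesis
    unfolding central_def by blast
qed

end

theory Submission imports Defs begin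

text \<open>If a central family \<open>C\<close> witnesses that \<open>A\<close> is central, then its images under \<open>\<Phi>\<close> witness
  that \<open>\<Phi> ` A\<close> is. The only point that needs the hypothesis on the range of \<open>\<Phi>\<close> is
  collectionwise piecewise syndeticity. Given a finite \<open>F\<close>, a translate \<open>F * z\<close> is moved into the
  range by finitely many left multipliers \<open>t\<close>, say \<open>t * f * z = \<Phi> (s f)\<close>; the witness \<open>x\<close> for the
  finite set of all \<open>s f\<close> in the domain then yields the witness \<open>z * \<Phi> x\<close> for \<open>F\<close>.\<close>

lemma Pf_image: "F \<in> Pf Y \<Longrightarrow> f ` Y \<subseteq> Z \<Longrightarrow> f ` F \<in> Pf Z"
  by (auto simp: Pf_def)

text \<open>Choice turns the hypothesis on the range into functions: \<open>s F f\<close> is a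
  preimage of \<open>t * (f * z F)\<close>. The multiplier \<open>t\<close> may vary with
  \<open>f\<close>, but \<open>G\<close> is fixed before \<open>F\<close>.\<close>

lemma piecewise_syndetic_range_lift:
  fixes \<Phi> :: "'s \<Rightarrow> 't::semigroup_mult"
  assumes "piecewise_syndetic (range \<Phi>)"
  obtains G z s where "G \<in> Pf UNIV"
    and "\<And>F f. F \<in> Pf UNIV \<Longrightarrow> f \<in> F \<Longrightarrow> \<exists>t\<in>G. t * (f * z F) = \<Phi> (s F f)"
proof -
  obtain G where G: "G \<in> Pf UNIV"
    and ex: "\<forall>F \<in> Pf UNIV. \<exists>x. (\<lambda>y. y * x) ` F \<subseteq> (\<Union>t\<in>G. left_quot t (range \<Phi>))"
    using assms unfolding piecewise_syndetic_def by blast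
  obtain z where "\<forall>F \<in> Pf UNIV. (\<lambda>y. y * z F) ` F \<subseteq> (\<Union>t\<in>G. left_quot t (range \<Phi>))"
    using bchoice[OF ex] by blast
  then have "\<exists>s. \<exists>t\<in>G. t * (f * z F) = \<Phi> s" if "F \<in> Pf UNIV" "f \<in> F" for F f
    using that unfolding left_quot_def by blast
  then obtain s where "\<And>F f. F \<in> Pf UNIV \<Longrightarrow> f \<in> F \<Longrightarrow> \<exists>t\<in>G. t * (f * z F) = \<Phi> (s F f)"
    by metis
  with G show ?thesis by (rule that)
qed

lemma collectionwise_piecewise_syndetic_image:
  fixes \<Phi> :: "'s::semigroup_mult \<Rightarrow> 't::semigroup_mult"
  assumes hom: "\<And>x y. \<Phi> (x * y) = \<Phi> x * \<Phi> y"
    and range: "piecewise_syndetic (range \<Phi>)"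
    and cps: "collectionwise_piecewise_syndetic \<A>"
  shows "collectionwise_piecewise_syndetic ((`) \<Phi> ` \<A>)"
proof -
  obtain K x where K: "K \<in> Pf \<A> \<rightarrow> Pf UNIV"
    and x: "\<forall>F \<in> Pf UNIV. \<forall>\<F> \<in> Pf \<A>. \<forall>\<H> \<in> Pf \<A>. \<F> \<subseteq> \<H> \<longrightarrow>
      (\<lambda>y. y * x \<H> F) ` F \<subseteq> (\<Union>t\<in>K \<F>. left_quot t (\<Inter>\<F>))"
    using cps unfolding collectionwise_piecewise_syndetic_def by (elim bexE exE)
  obtain G z s where G: "G \<in> Pf UNIV"
    and s: "\<And>F f. F \<in> Pf UNIV \<Longrightarrow> f \<in> F \<Longrightarrow> \<exists>t\<in>G. t * (f * z F) = \<Phi> (s F f)"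
    using piecewise_syndetic_range_lift[OF range] by blast
  \<comment> \<open>Distinct members of \<open>\<A>\<close> may have the same image, so
    \<open>r\<close> fixes one preimage for each. A fixed choice keeps inclusions:
    \<open>\<F> \<subseteq> \<H>\<close> gives \<open>r\<close> \<F> \<subseteq> r
    \<open>\<H>\<close>.\<close>
  define r where "r = inv_into \<A> ((`) \<Phi>)"
  have r_mem: "r ` ((`) \<Phi> ` \<A>) \<subseteq> \<A>"
    by (auto simp: r_def inv_into_into)
  have r_image: "\<Phi> ` r B = B" if "B \<in> (`) \<Phi> ` \<A>" for B
    using that by (simp add: r_def f_inv_into_f)
  \<comment> \<open>First \<open>t\<close> moves into the range, then \<open>k\<close> acts in the
    domain. Since \<open>G\<close> is independent of \<open>F\<close>, so is
    \<open>L \<F>\<close>.\<close>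
  define L where "L \<F> = (\<lambda>(k, t). \<Phi> k * t) ` (K (r ` \<F>) \<times> G)" for \<F>
  define w where "w \<H> F = z F * \<Phi> (x (r ` \<H>) (s F ` F))" for \<H> F
  have "L \<in> Pf ((`) \<Phi> ` \<A>) \<rightarrow> Pf UNIV"
  proof
    fix \<F> assume "\<F> \<in> Pf ((`) \<Phi> ` \<A>)"
    then have "K (r ` \<F>) \<in> Pf UNIV"
      using K r_mem by (blast intro: Pf_image)
    then show "L \<F> \<in> Pf UNIV"
      using G by (auto simp: L_def Pf_def)
  qed
  moreover have "(\<lambda>y. y * w \<H> F) ` F \<subseteq> (\<Union>t\<in>L \<F>. left_quot t (\<Inter>\<F>))"
    if F: "F \<in> Pf UNIV" and \<F>: "\<F> \<in> Pf ((`) \<Phi> ` \<A>)" and \<H>: "\<H> \<in> Pf ((`) \<Phi> ` \<A>)"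
      and sub: "\<F> \<subseteq> \<H>" for F \<F> \<H>
  proof (rule image_subsetI)
    fix f assume f: "f \<in> F"
    let ?x = "x (r ` \<H>) (s F ` F)"
    have "(\<lambda>y. y * ?x) ` s F ` F \<subseteq> (\<Union>t\<in>K (r ` \<F>). left_quot t (\<Inter>(r ` \<F>)))"
      using F \<F> \<H> sub r_mem by (intro x[rule_format] Pf_image image_mono) auto
    then obtain k where k: "k \<in> K (r ` \<F>)" and mem: "k * (s F f * ?x) \<in> \<Inter>(r ` \<F>)"
      using f unfolding left_quot_def by blast
    obtain t where t: "t \<in> G" "t * (f * z F) = \<Phi> (s F f)"
      using s[OF F f] by blast
    have "\<Phi> k * t * (f * w \<H> F) = \<Phi> k * (t * (f * z F)) * \<Phi> ?x"
      by (simp add: w_def mult.assoc)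
    also have "\<dots> = \<Phi> (k * (s F f * ?x))"
      by (simp add: t(2) hom mult.assoc)
    finally have eq: "\<Phi> k * t * (f * w \<H> F) = \<Phi> (k * (s F f * ?x))" .
    \<comment> \<open>The image of an intersection lies in the intersection of the images.\<close>
    have "\<Phi> (k * (s F f * ?x)) \<in> B" if "B \<in> \<F>" for B
    proof -
      have "\<Phi> ` r B = B"
        using that \<F> by (intro r_image) (auto simp: Pf_def)
      then show ?thesis using mem that by blast
    qed
    then have "f * w \<H> F \<in> left_quot (\<Phi> k * t) (\<Inter>\<F>)"
      by (simp add: left_quot_def eq)
    moreover have "\<Phi> k * t \<in> L \<F>"
      using k t(1) by (force simp: L_def)
    ultimately show "f * w \<H> F \<in> (\<Union>t\<in>L \<F>. left_quot t (\<Inter>\<F>))" by blast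
  qed
  ultimately show ?thesis
    unfolding collectionwise_piecewise_syndetic_def by (intro bexI[of _ L] exI[of _ w]) simp_all
qed

theorem theorem3p3:
  fixes \<Phi> :: "'s::semigroup_mult \<Rightarrow> 't::semigroup_mult" and A :: "'s set"
  assumes "\<And>x y. \<Phi> (x * y) = \<Phi> x * \<Phi> y"
    and "piecewise_syndetic (range \<Phi>)"
    and "central A"
  shows "central (\<Phi> ` A)"
proof -
  obtain I :: "'s set set" and ge and C :: "'s set \<Rightarrow> 's set" where C: "central_family I ge C A"
    using assms(3) unfolding central_def by blast
  let ?D = "\<lambda>i. \<Phi> ` C i"
  have "downward_directed I ge ?D"
    using C unfolding central_family_def downward_directed_def by (meson image_mono)
  moreover have "\<forall>i\<in>I. ?D i \<subseteq> \<Phi> ` A"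
    using C unfolding central_family_def by blast
  moreover have "\<exists>j\<in>I. ?D j \<subseteq> left_quot y (?D i)" if i: "i \<in> I" and y: "y \<in> ?D i" for i y
  proof -
    obtain x where x: "x \<in> C i" "y = \<Phi> x"
      using y by blast
    then obtain j where j: "j \<in> I" "C j \<subseteq> left_quot x (C i)"
      using C i unfolding central_family_def by blast
    \<comment> \<open>The index \<open>j\<close> chosen for the preimage \<open>x\<close> also
      serves \<open>y\<close>, because \<open>y * \<Phi> u = \<Phi> (x * u)\<close>.\<close>
    have "y * \<Phi> u \<in> ?D i" if "u \<in> C j" for u
      using that j(2) by (auto simp: x(2) left_quot_def simp flip: assms(1))
    then show ?thesis
      using j(1) by (auto simp: left_quot_def)
  qed
  moreover have "collectionwise_piecewise_syndetic (?D ` I)"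
    using collectionwise_piecewise_syndetic_image[OF assms(1,2), of "C ` I"] C
    by (simp add: central_family_def image_image)
  ultimately have "central_family I ge ?D (\<Phi> ` A)"
    unfolding central_family_def by blast
  \<comment> \<open>The indices are still of type \<open>'s set\<close>, whereas
    \<open>central\<close> on the codomain asks for \<open>'t set\<close>; \<open>centralI\<close>
    reindexes the family by its own members.\<close>
  then show ?thesis by (rule centralI)
qed

end
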